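(* For real $x>0$ let $f_{\mathbb{R}}(x)=\dfrac{(1/2)^x+\cos(\pi x)}{x}$. Then for all real $n>3$, $$\frac{(n-2)f_{\mathbb{R}}(n-2)+(n-3)f_{\mathbb{R}}(n-3)}{n f_{\mathbb{R}}(n)+(n-1)f_{\mathbb{R}}(n-1)}=4.$$ *)

theory Defs
  imports Complex_Main
begin

text \<open>The paper defines the function for positive arguments only; values at other arguments
  are irrelevant.\<close>

definition f_R :: "real \<Rightarrow> real" where
  "f_R x = ((1/2) powr x + cos (pi * x)) / x"

end

theory Submission
  imports Defs
begin

text \<open>
  Multiplying \<open>f_R x\<close> by \<open>x\<close> leaves a geometric term plus a cosine that changes sign under the shift
  \<open>x \<mapsto> x - 1\<close>. Adding the values at two arguments one apart therefore cancels the cosines and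
  leaves a multiple of \<open>(1/2) powr x\<close> alone (lemma \<open>adjacent_sum\<close>). Numerator and denominator are
  two such sums, taken two units apart, so their quotient is \<open>(1/2) powr (-2) = 4\<close>.
\<close>

lemma adjacent_sum:
  fixes x :: real
  assumes "x > 1"
  shows "x * f_R x + (x - 1) * f_R (x - 1) = 3 * (1/2) powr x"
proof -
  have "cos (pi * (x - 1)) = - cos (pi * x)"
    by (simp add: right_diff_distrib cos_diff)
  moreover have "(1/2::real) powr (x - 1) = 2 * (1/2) powr x"
    by (simp add: powr_diff)
  ultimately show ?thesis
    using assms by (simp add: f_R_def)
qed

theorem mainTheorem2:
  fixes n :: real
  assumes "n > 3"
  shows "((n - 2) * f_R (n - 2) + (n - 3) * f_R (n - 3))
           / (n * f_R n + (n - 1) * f_R (n - 1)) = 4"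
proof -
  have "(n - 2) * f_R (n - 2) + (n - 3) * f_R (n - 3) = 3 * (1/2) powr (n - 2)"
    using adjacent_sum[of "n - 2"] assms by simp
  also have "\<dots> = 4 * (3 * (1/2) powr n)"
    by (simp add: powr_diff power2_eq_square)
  finally show ?thesis
    using adjacent_sum[of n] assms by simp
qed

end
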